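(* Let $\tau_1,\tau_2,\dots,\tau_{n+1}$ be types in an intensional model $\mathcal{M}_{int}$ ($n\ge 1$), and let $$f_1:\mathcal{D}_{\tau_1}\to\mathcal{D}_{\tau_2},\quad f_2:\mathcal{D}_{\tau_2}\to\mathcal{D}_{\tau_3},\quad\dots,\quad f_n:\mathcal{D}_{\tau_n}\to\mathcal{D}_{\tau_{n+1}}$$ be a sequence of semantic functions. Let $h_{\tau_i}:\mathcal{D}_{\tau_i}\to\mathcal{S}_{\mathcal{D}_{\tau_i}}$ be the injective embeddings (constructed by recursion on types as in the context), and let $$f_i':\operatorname{im}(h_{\tau_i})\to\operatorname{im}(h_{\tau_{i+1}})$$ be the lifted maps satisfying $f_i'(h_{\tau_i}(x))=h_{\tau_{i+1}}(f_i(x))$ for all $x\in\mathcal{D}_{\tau_i}$. Then for any $x\in\mathcal{D}_{\tau_1}$, $$h_{\tau_{n+1}}\big((f_n\circ f_{n-1}\circ\cdots\circ f_1)(x)\big)=(f_n'\circ f_{n-1}'\circ\cdots\circ f_1')(h_{\tau_1}(x)).$$ That is, the diagram with top row $f_1,\dots,f_n$ between the domains $\mathcal{D}_{\tau_i}$, bottom row $f_1',\dots,f_n'$ between the images $\operatorname{im}(h_{\tau_i})$, and vertical maps $h_{\tau_1},\dots,h_{\tau_{n+1}}$ commutes.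
   Context: Let $\Sigma$ be a non-empty set of index sorts. The set $\mathcal{T}$ of intensional types is the smallest set containing $e$ (entities), $t$ (truth values) and every $\sigma\in\Sigma$, and containing $\langle\alpha,\beta\rangle$ whenever $\alpha,\beta\in\mathcal{T}$. The types $e$, $t$ and $\sigma\in\Sigma$ are primitive. An intensional model $\mathcal{M}_{int}$ consists of the following. (i) Domains: $\mathcal{D}_e$ is a non-empty set, $\mathcal{D}_t=\{0,1\}$, $\mathcal{D}_\sigma$ is a non-empty set for each $\sigma\in\Sigma$, and $\mathcal{D}_{\langle\alpha,\beta\rangle}$ is the set of all functions $\mathcal{D}_\alpha\to\mathcal{D}_\beta$. (ii) For each $\sigma\in\Sigma$, an accessibility relation $\mathcal{R}_\sigma\subseteq\mathcal{D}_\sigma\times\mathcal{D}_\sigma$. (iii) The compound index space $S=\prod_{\sigma\in\Sigma}\mathcal{D}_\sigma$, which is treated as a further primitive domain. (iv) An interpretation assigning to each non-logical constant of type $\tau$ a function $S\to\mathcal{D}_\tau$. A semantic function is a function between such domains. The vector spaces $\mathcal{S}_{\mathcal{D}_\tau}$ and the injective embeddings $h_\tau:\mathcal{D}_\tau\to\mathcal{S}_{\mathcal{D}_\tau}$ are constructed by recursion on types. For $e$, for each $\sigma\in\Sigma$, and for $S$ (whose space is denoted $\mathcal{S}_S$), the space has an orthonormal basis $\{\mathbf{b}_a\}$ indexed by the elements $a$ of the domain. It is a real vector space of dimension equal to the cardinality of the domain if the domain is finite, and an infinite-dimensional Hilbert space with orthonormal basis indexed by the domain if it is infinite. The embedding is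 $a\mapsto\mathbf{b}_a$. For $t$, $\mathcal{S}_{\mathcal{D}_t}=\mathbb{R}^2$, with $h_t(1)=\mathbf{b}_1=(1,0)^\top$ and $h_t(0)=\mathbf{b}_0=(0,1)^\top$. For a function type $\tau=\langle\alpha,\beta\rangle$, with $h_\alpha$ and $h_\beta$ already constructed, $\mathcal{S}_{\mathcal{D}_\tau}=\operatorname{Hom}(\mathcal{S}_{\mathcal{D}_\alpha},\mathcal{S}_{\mathcal{D}_\beta})$, the vector space of all linear maps from $\mathcal{S}_{\mathcal{D}_\alpha}$ to $\mathcal{S}_{\mathcal{D}_\beta}$. For $f\in\mathcal{D}_\tau$, $h_\tau(f)$ is the linear map defined on basis vectors by $h_\tau(f)(\mathbf{b}_a)=h_\beta(f(a))$ for each $a\in\mathcal{D}_\alpha$ (where $\mathbf{b}_a$ is the basis vector of $\mathcal{S}_{\mathcal{D}_\alpha}$ corresponding to $a$) and extended linearly to all of $\mathcal{S}_{\mathcal{D}_\alpha}$. Types $\langle S,\alpha\rangle$ of functions $S\to\mathcal{D}_\alpha$ are treated in the same way, with $\mathcal{S}_{\mathcal{D}_{\langle S,\alpha\rangle}}=\operatorname{Hom}(\mathcal{S}_S,\mathcal{S}_{\mathcal{D}_\alpha})$. Here $\operatorname{im}(h_\tau)\subseteq\mathcal{S}_{\mathcal{D}_\tau}$ denotes the image of $h_\tau$. *)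

theory Defs
  imports "HOL-Analysis.Analysis"
begin

text \<open>
  The type variable \<open>'s\<close> is the non-empty set \<open>\<Sigma>\<close> of index sorts.  \<open>Cmp\<close> is the further
  primitive domain \<open>S\<close> of compound indices; the types not containing \<open>Cmp\<close> are exactly the
  intensional types in the strict sense.
\<close>

datatype 's ty = Ent | Tv | Srt 's | Cmp | Fun "'s ty" "'s ty"

primrec primitive :: "'s ty \<Rightarrow> bool" where
  "primitive Ent = True"
| "primitive Tv = True"
| "primitive (Srt \<sigma>) = True"
| "primitive Cmp = True"
| "primitive (Fun \<alpha> \<beta>) = False"

primrec intensional :: "'s ty \<Rightarrow> bool" where
  "intensional Ent = True"
| "intensional Tv = True"
| "intensional (Srt \<sigma>) = True"
| "intensional Cmp = False"
| "intensional (Fun \<alpha> \<beta>) = (intensional \<alpha> \<and> intensional \<beta>)"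

text \<open>
  All domains live in one carrier type \<open>'u\<close>, because a sequence of domains of varying types has
  to be indexed by a natural number.  An element of \<open>Dom (Fun \<alpha> \<beta>)\<close> represents a function through
  \<open>App \<alpha> \<beta>\<close>, and an element of \<open>Dom Cmp\<close> represents a tuple through \<open>Proj\<close>; the bijections
  required below make these domains the full function space and the full product.

  \<open>Types\<close> is the set of types realised in \<open>'u\<close>.  The intended choice is \<open>UNIV\<close>, but for an infinite
  primitive domain no HOL type can be shown to accommodate the full function spaces of all finite
  types at once, whereas this is possible for the components of any finite list of types.  So
  \<open>Types\<close> may be any set of types that contains the primitive ones and is closed under components.
\<close>

record ('s, 'u, 'c) int_model =
  Types :: "'s ty set"
  Dom :: "'s ty \<Rightarrow> 'u set"
  True_val :: 'u
  False_val :: 'u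
  App :: "'s ty \<Rightarrow> 's ty \<Rightarrow> 'u \<Rightarrow> 'u \<Rightarrow> 'u"
  Proj :: "'u \<Rightarrow> 's \<Rightarrow> 'u"
  Acc :: "'s \<Rightarrow> ('u \<times> 'u) set"
  Con :: "'c set"
  Con_type :: "'c \<Rightarrow> 's ty"
  Interp :: "'c \<Rightarrow> 'u \<Rightarrow> 'u"

locale intensional_model =
  fixes M :: "('s, 'u, 'c) int_model"
  assumes types_primitive: "primitive \<tau> \<Longrightarrow> \<tau> \<in> Types M"
    and types_components: "Fun \<alpha> \<beta> \<in> Types M \<Longrightarrow> \<alpha> \<in> Types M \<and> \<beta> \<in> Types M"
    and dom_ent: "Dom M Ent \<noteq> {}"
    and dom_tv: "Dom M Tv = {True_val M, False_val M}" "True_val M \<noteq> False_val M"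
    and dom_srt: "Dom M (Srt \<sigma>) \<noteq> {}"
    and dom_cmp: "bij_betw (Proj M) (Dom M Cmp) (\<Pi>\<^sub>E \<sigma>\<in>UNIV. Dom M (Srt \<sigma>))"
    and dom_fun: "Fun \<alpha> \<beta> \<in> Types M \<Longrightarrow>
      bij_betw (\<lambda>f. restrict (App M \<alpha> \<beta> f) (Dom M \<alpha>)) (Dom M (Fun \<alpha> \<beta>)) (Dom M \<alpha> \<rightarrow>\<^sub>E Dom M \<beta>)"
    and acc: "Acc M \<sigma> \<subseteq> Dom M (Srt \<sigma>) \<times> Dom M (Srt \<sigma>)"
    and con_type: "c \<in> Con M \<Longrightarrow> Con_type M c \<in> Types M \<and> intensional (Con_type M c)"
    and interp: "c \<in> Con M \<Longrightarrow> Interp M c \<in> Dom M Cmp \<rightarrow> Dom M (Con_type M c)"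

definition Hom :: "'v::real_vector set \<Rightarrow> 'v set \<Rightarrow> ('v \<Rightarrow> 'v) set" where
  "Hom V W = {L \<in> V \<rightarrow>\<^sub>E W. (\<forall>x\<in>V. \<forall>y\<in>V. L (x + y) = L x + L y) \<and>
                          (\<forall>r. \<forall>x\<in>V. L (r *\<^sub>R x) = r *\<^sub>R L x)}"

text \<open>
  For finite \<open>A\<close> this says that \<open>V\<close> is a Euclidean space of dimension \<open>card A\<close> with orthonormal
  basis \<open>b ` A\<close> (the span is then already closed); for infinite \<open>A\<close> it says that \<open>V\<close> is a Hilbert
  space with orthonormal basis \<open>b ` A\<close>.
\<close>

definition orthonormal_basis :: "('u \<Rightarrow> 'v::real_inner) \<Rightarrow> 'u set \<Rightarrow> 'v set \<Rightarrow> bool" where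
  "orthonormal_basis b A V \<longleftrightarrow>
     (\<forall>a\<in>A. \<forall>a'\<in>A. b a \<bullet> b a' = (if a = a' then 1 else 0)) \<and>
     complete V \<and> V = closure (span (b ` A))"

text \<open>
  The spaces are realised as subspaces of one ambient space \<open>'v\<close>.  The inner product of \<open>'v\<close> is
  used only at primitive types; a vector in \<open>Space (Fun \<alpha> \<beta>)\<close> represents a linear map through
  \<open>VApp \<alpha> \<beta>\<close>, and this representation is an isomorphism of vector spaces onto the space of all
  linear maps.  At the type \<open>Tv\<close>, \<open>Space Tv\<close> is the real plane, coordinatised by the orthonormal
  basis \<open>Basis_vec Tv True_val\<close> (the vector (1,0)) and \<open>Basis_vec Tv False_val\<close> (the vector (0,1)).
\<close>

record ('s, 'u, 'v) vec_model =
  Space :: "'s ty \<Rightarrow> 'v set"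
  Basis_vec :: "'s ty \<Rightarrow> 'u \<Rightarrow> 'v"
  VApp :: "'s ty \<Rightarrow> 's ty \<Rightarrow> 'v \<Rightarrow> 'v \<Rightarrow> 'v"

locale vector_model = intensional_model M
  for M :: "('s, 'u, 'c) int_model" +
  fixes V :: "('s, 'u, 'v::real_inner) vec_model"
  assumes space_subspace: "\<tau> \<in> Types M \<Longrightarrow> subspace (Space V \<tau>)"
    and space_primitive: "primitive \<tau> \<Longrightarrow> orthonormal_basis (Basis_vec V \<tau>) (Dom M \<tau>) (Space V \<tau>)"
    and space_fun: "Fun \<alpha> \<beta> \<in> Types M \<Longrightarrow>
      bij_betw (\<lambda>L. restrict (VApp V \<alpha> \<beta> L) (Space V \<alpha>)) (Space V (Fun \<alpha> \<beta>))
        (Hom (Space V \<alpha>) (Space V \<beta>))"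
    and vapp_add: "\<lbrakk>Fun \<alpha> \<beta> \<in> Types M; K \<in> Space V (Fun \<alpha> \<beta>); L \<in> Space V (Fun \<alpha> \<beta>); x \<in> Space V \<alpha>\<rbrakk>
      \<Longrightarrow> VApp V \<alpha> \<beta> (K + L) x = VApp V \<alpha> \<beta> K x + VApp V \<alpha> \<beta> L x"
    and vapp_scale: "\<lbrakk>Fun \<alpha> \<beta> \<in> Types M; L \<in> Space V (Fun \<alpha> \<beta>); x \<in> Space V \<alpha>\<rbrakk>
      \<Longrightarrow> VApp V \<alpha> \<beta> (r *\<^sub>R L) x = r *\<^sub>R VApp V \<alpha> \<beta> L x"

text \<open>
  The vector \<open>L\<close> of \<open>Space (Fun \<alpha> \<beta>)\<close> is a linear map sending the vector of \<open>a\<close> to the vector of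
  \<open>f a\<close>, where the vector corresponding to \<open>a\<close> is its embedding (at primitive \<open>\<alpha>\<close>, the basis
  vector of \<open>a\<close>).
\<close>

definition linear_extension ::
  "('s, 'u, 'c) int_model \<Rightarrow> ('s, 'u, 'v) vec_model \<Rightarrow> ('s ty \<Rightarrow> 'u \<Rightarrow> 'v) \<Rightarrow>
   's ty \<Rightarrow> 's ty \<Rightarrow> 'u \<Rightarrow> 'v \<Rightarrow> bool" where
  "linear_extension M V h \<alpha> \<beta> f L \<longleftrightarrow>
     L \<in> Space V (Fun \<alpha> \<beta>) \<and> (\<forall>a\<in>Dom M \<alpha>. VApp V \<alpha> \<beta> L (h \<alpha> a) = h \<beta> (App M \<alpha> \<beta> f a))"

text \<open>
  The linear extension need not be unique (an orthonormal basis of an infinite-dimensional Hilbert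
  space is not a Hamel basis), so \<open>h\<close> is any family obtained from some choice of extensions.  It
  exists for every primitive \<open>\<alpha>\<close> (\<open>linear_extension_exists\<close> below), and then injectivity is
  automatic (\<open>linear_extension_inj\<close>).  If \<open>\<alpha>\<close> is itself a function type, the vectors of the
  elements of its domain can be linearly dependent (already for \<open>Fun Tv Tv\<close>), so that some \<open>f\<close>
  has no extension; on such \<open>f\<close> the family is only required to be an injective embedding.
\<close>

locale embeddings = vector_model M V
  for M :: "('s, 'u, 'c) int_model" and V :: "('s, 'u, 'v::real_inner) vec_model" +
  fixes h :: "'s ty \<Rightarrow> 'u \<Rightarrow> 'v"
  assumes h_space: "\<tau> \<in> Types M \<Longrightarrow> h \<tau> \<in> Dom M \<tau> \<rightarrow> Space V \<tau>"
    and h_inj: "\<tau> \<in> Types M \<Longrightarrow> inj_on (h \<tau>) (Dom M \<tau>)"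
    and h_primitive: "\<lbrakk>primitive \<tau>; a \<in> Dom M \<tau>\<rbrakk> \<Longrightarrow> h \<tau> a = Basis_vec V \<tau> a"
    and h_fun: "\<lbrakk>Fun \<alpha> \<beta> \<in> Types M; f \<in> Dom M (Fun \<alpha> \<beta>); \<exists>L. linear_extension M V h \<alpha> \<beta> f L\<rbrakk>
      \<Longrightarrow> linear_extension M V h \<alpha> \<beta> f (h (Fun \<alpha> \<beta>) f)"

lemma (in vector_model) linear_extension_exists:
  assumes ty: "Fun \<alpha> \<beta> \<in> Types M" and p: "primitive \<alpha>" and f: "f \<in> Dom M (Fun \<alpha> \<beta>)"
    and h\<alpha>: "\<And>a. a \<in> Dom M \<alpha> \<Longrightarrow> h \<alpha> a = Basis_vec V \<alpha> a"
    and h\<beta>: "h \<beta> \<in> Dom M \<beta> \<rightarrow> Space V \<beta>"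
  shows "\<exists>L. linear_extension M V h \<alpha> \<beta> f L"
proof -
  let ?b = "Basis_vec V \<alpha>" and ?A = "Dom M \<alpha>"
  let ?g = "\<lambda>v. h \<beta> (App M \<alpha> \<beta> f (inv_into ?A ?b v))"
  have on: "\<forall>a\<in>?A. \<forall>a'\<in>?A. ?b a \<bullet> ?b a' = (if a = a' then 1 else 0)"
    and cl: "Space V \<alpha> = closure (span (?b ` ?A))"
    using space_primitive[OF p] by (auto simp: orthonormal_basis_def)
  have inj: "inj_on ?b ?A"
    using on by (metis inj_onI zero_neq_one)
  have "0 \<notin> ?b ` ?A"
  proof
    assume "0 \<in> ?b ` ?A"
    then obtain a where "a \<in> ?A" "?b a = 0"
      by force
    then show False
      using on by force
  qed
  moreover have "pairwise orthogonal (?b ` ?A)"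
    unfolding pairwise_def orthogonal_def using on by auto
  ultimately have "independent (?b ` ?A)"
    by (intro pairwise_orthogonal_independent)
  from linear_independent_extend_subspace[OF this, of ?g]
  obtain L where L: "linear L" "\<forall>v\<in>?b ` ?A. L v = ?g v" "range L = span (?g ` ?b ` ?A)"
    by metis
  have app: "App M \<alpha> \<beta> f a \<in> Dom M \<beta>" if "a \<in> ?A" for a
    using bij_betwE[OF dom_fun[OF ty]] f that by (auto simp: PiE_iff)
  have "?g ` ?b ` ?A \<subseteq> Space V \<beta>"
    using app h\<beta> inj by auto
  then have "range L \<subseteq> Space V \<beta>"
    using L(3) types_components[OF ty] space_subspace span_minimal[of _ "Space V \<beta>"] by simp
  moreover have "subspace (Space V \<alpha>)"
    using p space_subspace types_primitive by blast
  ultimately have "restrict L (Space V \<alpha>) \<in> Hom (Space V \<alpha>) (Space V \<beta>)"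
    using L(1) by (auto simp: Hom_def linear_add linear_scale subspace_add subspace_scale)
  then have "restrict L (Space V \<alpha>) \<in>
      (\<lambda>L. restrict (VApp V \<alpha> \<beta> L) (Space V \<alpha>)) ` Space V (Fun \<alpha> \<beta>)"
    using bij_betw_imp_surj_on[OF space_fun[OF ty]] by simp
  then obtain K where K: "K \<in> Space V (Fun \<alpha> \<beta>)"
    "restrict (VApp V \<alpha> \<beta> K) (Space V \<alpha>) = restrict L (Space V \<alpha>)"
    by force
  have "VApp V \<alpha> \<beta> K (h \<alpha> a) = h \<beta> (App M \<alpha> \<beta> f a)" if a: "a \<in> ?A" for a
  proof -
    have "?b a \<in> Space V \<alpha>"
      unfolding cl by (intro subsetD[OF closure_subset] span_base imageI a)
    then have "VApp V \<alpha> \<beta> K (?b a) = L (?b a)"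
      using fun_cong[OF K(2), of "?b a"] by simp
    then show ?thesis
      using L(2) a inj h\<alpha>[OF a] by simp
  qed
  then show ?thesis
    using K(1) by (auto simp: linear_extension_def)
qed

lemma (in vector_model) linear_extension_inj:
  assumes ty: "Fun \<alpha> \<beta> \<in> Types M" and inj: "inj_on (h \<beta>) (Dom M \<beta>)"
    and ext: "\<And>f. f \<in> Dom M (Fun \<alpha> \<beta>) \<Longrightarrow> linear_extension M V h \<alpha> \<beta> f (h (Fun \<alpha> \<beta>) f)"
  shows "inj_on (h (Fun \<alpha> \<beta>)) (Dom M (Fun \<alpha> \<beta>))"
proof (rule inj_onI)
  fix f g
  assume f: "f \<in> Dom M (Fun \<alpha> \<beta>)" and g: "g \<in> Dom M (Fun \<alpha> \<beta>)" and eq: "h (Fun \<alpha> \<beta>) f = h (Fun \<alpha> \<beta>) g"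
  have "App M \<alpha> \<beta> f a = App M \<alpha> \<beta> g a" if a: "a \<in> Dom M \<alpha>" for a
  proof (rule inj_onD[OF inj])
    show "h \<beta> (App M \<alpha> \<beta> f a) = h \<beta> (App M \<alpha> \<beta> g a)"
      using ext[OF f] ext[OF g] eq a by (auto simp: linear_extension_def)
    show "App M \<alpha> \<beta> f a \<in> Dom M \<beta>" "App M \<alpha> \<beta> g a \<in> Dom M \<beta>"
      using bij_betwE[OF dom_fun[OF ty]] f g a by (auto simp: PiE_iff)
  qed
  then have "restrict (App M \<alpha> \<beta> f) (Dom M \<alpha>) = restrict (App M \<alpha> \<beta> g) (Dom M \<alpha>)"
    by (auto simp: restrict_def)
  then show "f = g"
    using bij_betw_imp_inj_on[OF dom_fun[OF ty]] f g by (auto dest: inj_onD)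
qed

end

theory Submission
  imports Defs
begin

text \<open>
  The reason is that commuting squares paste: two squares side by side form a commuting rectangle,
  since the common vertical map of the two turns the lower composite into the upper one. The
  row of \<open>n\<close> squares whose vertical maps are the embeddings is pasted from the left, one square
  at a time.
\<close>

text \<open>
  Commutation of a square is known only on its upper left corner \<open>A i\<close>, so the induction along the
  row carries the membership of the partial composite in \<open>A k\<close> together with the equation.
\<close>

lemma fold_commuting_squares:
  fixes f :: "nat \<Rightarrow> 'a \<Rightarrow> 'a" and f' :: "nat \<Rightarrow> 'b \<Rightarrow> 'b" and g :: "nat \<Rightarrow> 'a \<Rightarrow> 'b"
  assumes "m \<le> k" and "x \<in> A m"
    and "\<And>i. i \<in> {m..<k} \<Longrightarrow> f i \<in> A i \<rightarrow> A (Suc i)"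
    and "\<And>i y. i \<in> {m..<k} \<Longrightarrow> y \<in> A i \<Longrightarrow> f' i (g i y) = g (Suc i) (f i y)"
  shows "fold f [m..<k] x \<in> A k \<and> g k (fold f [m..<k] x) = fold f' [m..<k] (g m x)"
  using assms
proof (induction k rule: dec_induct)
  case base
  then show ?case by simp
next
  case (step k)
  let ?y = "fold f [m..<k] x"
  have IH: "?y \<in> A k" "g k ?y = fold f' [m..<k] (g m x)"
    using step by simp_all
  have "f k ?y \<in> A (Suc k)"
    using step.prems(2)[of k] step.hyps IH(1) by auto
  moreover have "f' k (g k ?y) = g (Suc k) (f k ?y)"
    using step.prems(3)[of k] step.hyps IH(1) by simp
  ultimately show ?case
    using step.hyps IH(2) by simp
qed

theorem theorem6p2:
  fixes M :: "('s, 'u, 'c) int_model"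
    and V :: "('s, 'u, 'v::real_inner) vec_model"
    and h :: "'s ty \<Rightarrow> 'u \<Rightarrow> 'v"
    and \<tau> :: "nat \<Rightarrow> 's ty"
    and f :: "nat \<Rightarrow> 'u \<Rightarrow> 'u"
    and f' :: "nat \<Rightarrow> 'v \<Rightarrow> 'v"
    and n :: nat and x :: 'u
  assumes "embeddings M V h"
    and "n \<ge> 1"
    and "\<And>i. i \<in> {1..n + 1} \<Longrightarrow> \<tau> i \<in> Types M"
    and "\<And>i. i \<in> {1..n} \<Longrightarrow> f i \<in> Dom M (\<tau> i) \<rightarrow> Dom M (\<tau> (i + 1))"
    and "\<And>i. i \<in> {1..n} \<Longrightarrow> f' i \<in> h (\<tau> i) ` Dom M (\<tau> i) \<rightarrow> h (\<tau> (i + 1)) ` Dom M (\<tau> (i + 1))"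
    and "\<And>i y. i \<in> {1..n} \<Longrightarrow> y \<in> Dom M (\<tau> i) \<Longrightarrow> f' i (h (\<tau> i) y) = h (\<tau> (i + 1)) (f i y)"
    and "x \<in> Dom M (\<tau> 1)"
  shows "h (\<tau> (n + 1)) (fold f [1..<n + 1] x) = fold f' [1..<n + 1] (h (\<tau> 1) x)"
  using fold_commuting_squares[of 1 "n + 1" x "\<lambda>i. Dom M (\<tau> i)" f f' "\<lambda>i. h (\<tau> i)"] assms
  by auto

end
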